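(* There is a natural bijection between $\mathfrak{Ad}_n^k$ and $\mathfrak{Ad}_n^{n-k-1}$.
   Context: Here $\mathfrak g=\mathfrak{sl}_n$, with the standard Borel subalgebra $\mathfrak b$ of upper-triangular matrices and the Cartan subalgebra of diagonal matrices; $\Delta$ is the root system and $\Delta^+$ the set of positive roots (the roots of $\mathfrak b$). Positive roots are identified with pairs $(i,j)$, $1\le i<j\le n$, where $\alpha_i=(i,i+1)$ are the simple roots. An $\mathsf{ad}$-nilpotent ideal is an ideal of $\mathfrak b$ contained in $[\mathfrak b,\mathfrak b]$; it is identified with its set of roots, that is, with a subset $I\subset\Delta^+$ such that $\gamma\in I$, $\nu\in\Delta^+$, $\gamma+\nu\in\Delta$ imply $\gamma+\nu\in I$. An element $\gamma\in I$ is a generator of $I$ if $\gamma-\alpha\notin I$ for all $\alpha\in\Delta^+$. For $0\le k\le n-1$, $\mathfrak{Ad}_n^k$ denotes the set of $\mathsf{ad}$-nilpotent ideals of $\mathfrak{sl}_n$ with exactly $k$ generators. *)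

theory Defs
  imports Main "HOL-Library.Function_Algebras"
begin

text \<open>
  Roots of \<open>sl_n\<close> as integer coordinate vectors: \<open>sl_root i j\<close> is the functional
  \<open>diag (t_1, \<dots>, t_n) \<mapsto> t_i - t_j\<close>.  Positive roots are the ones with
  \<open>1 \<le> i < j \<le> n\<close>, identified with the pairs \<open>(i, j)\<close>; the simple roots are
  \<open>sl_root i (i + 1)\<close>.  Sums and differences of roots are taken pointwise.
\<close>

definition eps :: "nat \<Rightarrow> nat \<Rightarrow> int" where
  "eps i = (\<lambda>m. if m = i then 1 else 0)"

definition sl_root :: "nat \<Rightarrow> nat \<Rightarrow> (nat \<Rightarrow> int)" where
  "sl_root i j = eps i - eps j"

definition roots :: "nat \<Rightarrow> (nat \<Rightarrow> int) set" where
  "roots n = {sl_root i j | i j. i \<in> {1..n} \<and> j \<in> {1..n} \<and> i \<noteq> j}"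

definition pos_roots :: "nat \<Rightarrow> (nat \<Rightarrow> int) set" where
  "pos_roots n = {sl_root i j | i j. 1 \<le> i \<and> i < j \<and> j \<le> n}"

text \<open>An ad-nilpotent ideal of the Borel subalgebra, identified with its set of roots.\<close>

definition ad_nilpotent_ideal :: "nat \<Rightarrow> (nat \<Rightarrow> int) set \<Rightarrow> bool" where
  "ad_nilpotent_ideal n I \<longleftrightarrow> I \<subseteq> pos_roots n \<and>
     (\<forall>\<gamma>\<in>I. \<forall>\<nu>\<in>pos_roots n. \<gamma> + \<nu> \<in> roots n \<longrightarrow> \<gamma> + \<nu> \<in> I)"

definition generators :: "nat \<Rightarrow> (nat \<Rightarrow> int) set \<Rightarrow> (nat \<Rightarrow> int) set" where
  "generators n I = {\<gamma> \<in> I. \<forall>\<alpha>\<in>pos_roots n. \<gamma> - \<alpha> \<notin> I}"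

definition Ad :: "nat \<Rightarrow> nat \<Rightarrow> (nat \<Rightarrow> int) set set" where
  "Ad n k = {I. ad_nilpotent_ideal n I \<and> card (generators n I) = k}"

definition gen_rows :: "nat \<Rightarrow> (nat \<Rightarrow> int) set \<Rightarrow> nat set" where
  "gen_rows n I = {i. \<exists>j. sl_root i j \<in> generators n I}"

definition gen_cols :: "nat \<Rightarrow> (nat \<Rightarrow> int) set \<Rightarrow> nat set" where
  "gen_cols n I = {j. \<exists>i. sl_root i j \<in> generators n I}"

text \<open>
  The generators of an ideal form an antichain \<open>(i_1, j_1), \<dots>, (i_k, j_k)\<close> with
  \<open>i_1 < \<dots> < i_k\<close> and \<open>j_1 < \<dots> < j_k\<close>, so an ideal is determined by its sets of rows
  and columns of generators.  Writing a positive root as a sum of consecutive simple roots,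
  \<open>(i, j)\<close> starts at \<open>\<alpha>_i\<close> and ends at \<open>\<alpha>_(j - 1)\<close>.  Two ideals are dual if the
  generators of one start exactly at the simple roots where no generator of the other ends,
  and end exactly at those where no generator of the other starts.
\<close>

definition dual_ideals :: "nat \<Rightarrow> (nat \<Rightarrow> int) set \<Rightarrow> (nat \<Rightarrow> int) set \<Rightarrow> bool" where
  "dual_ideals n I J \<longleftrightarrow>
     gen_rows n J = {1..n - 1} - (\<lambda>j. j - 1) ` gen_cols n I \<and>
     (\<lambda>j. j - 1) ` gen_cols n J = {1..n - 1} - gen_rows n I"

end

theory Submission
  imports Defs
begin

text \<open>
  Record an ideal by the set \<open>A\<close> of simple roots at which its generators start and the set \<open>B\<close>
  of those at which they end. Both have as many elements as there are generators, and since a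
  generator starts no later than it ends, every initial segment of \<open>{1..n - 1}\<close> contains at
  least as many elements of \<open>A\<close> as of \<open>B\<close>. Conversely such a pair comes from exactly one ideal,
  namely the roots \<open>(i, j)\<close> such that \<open>B\<close> has more elements below \<open>j\<close> than \<open>A\<close> has below \<open>i\<close>.
  The counting condition on \<open>(A, B)\<close> is invariant under replacing \<open>(A, B)\<close> by the pair of
  complements of \<open>B\<close> and \<open>A\<close>.
\<close>

section \<open>Arithmetic of the roots of sl_n\<close>

lemma sl_root_eq_iff:
  assumes "i \<noteq> j"
  shows "sl_root i j = sl_root p q \<longleftrightarrow> i = p \<and> j = q"
proof
  assume eq: "sl_root i j = sl_root p q"
  have "sl_root i j i = sl_root p q i" "sl_root i j j = sl_root p q j"
    using eq by simp_all
  then show "i = p \<and> j = q"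
    using assms by (auto simp: sl_root_def eps_def split: if_splits)
qed simp

lemma sl_root_in_pos_roots_iff:
  "sl_root i j \<in> pos_roots n \<longleftrightarrow> 1 \<le> i \<and> i < j \<and> j \<le> n"
proof
  assume "sl_root i j \<in> pos_roots n"
  then obtain p q where "sl_root i j = sl_root p q" "1 \<le> p" "p < q" "q \<le> n"
    by (auto simp: pos_roots_def)
  then show "1 \<le> i \<and> i < j \<and> j \<le> n"
    by (metis less_irrefl sl_root_eq_iff)
qed (auto simp: pos_roots_def)

lemma sl_root_add: "sl_root i j + sl_root j q = sl_root i q"
  by (simp add: sl_root_def)

lemma pos_roots_subset_roots: "pos_roots n \<subseteq> roots n"
  by (force simp: pos_roots_def roots_def)

lemma sl_root_add_in_roots:
  assumes "sl_root i j + sl_root p q \<in> roots n" and "i < j" and "p < q"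
  shows "j = p \<or> q = i"
proof (rule ccontr)
  assume ne: "\<not> (j = p \<or> q = i)"
  obtain u v where "u \<noteq> v" and eq: "sl_root i j + sl_root p q = sl_root u v"
    using assms(1) by (auto simp: roots_def)
  have at: "sl_root i j m + sl_root p q m = sl_root u v m" for m
    using eq by (metis plus_fun_apply)
  \<comment> \<open>By \<open>ne\<close> nothing cancels the 1 at the coordinates \<open>i\<close>
    and \<open>p\<close>, while a root is positive at a single coordinate, with value 1. So
    \<open>i = p\<close>, and there the sum would be 2.\<close>
  have "u = i" "u = p"
    using at[of i] at[of p] ne assms(2,3) \<open>u \<noteq> v\<close>
    by (auto simp: sl_root_def eps_def split: if_splits)
  then show False
    using at[of u] assms(2,3) \<open>u \<noteq> v\<close> by (auto simp: sl_root_def eps_def split: if_splits)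
qed

text \<open>The only ways to split a root (i, j) into two positive roots are (i, m) + (m, j) with i
  < m < j, and either summand may be the one that is subtracted.\<close>

lemma sl_root_in_generators_iff:
  assumes "I \<subseteq> pos_roots n"
  shows "sl_root i j \<in> generators n I \<longleftrightarrow>
    sl_root i j \<in> I \<and> (\<forall>m. i < m \<and> m < j \<longrightarrow> sl_root i m \<notin> I \<and> sl_root m j \<notin> I)"
proof (intro iffI conjI allI impI)
  assume gen: "sl_root i j \<in> generators n I"
  then show ij: "sl_root i j \<in> I"
    by (simp add: generators_def)
  fix m assume m: "i < m \<and> m < j"
  have "sl_root i m \<in> pos_roots n" "sl_root m j \<in> pos_roots n"
    using m ij assms sl_root_in_pos_roots_iff[of i j n]
    by (auto simp: sl_root_in_pos_roots_iff)
  moreover have "sl_root i j - sl_root m j = sl_root i m" "sl_root i j - sl_root i m = sl_root m j"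
    by (simp_all add: sl_root_def)
  ultimately show "sl_root i m \<notin> I" "sl_root m j \<notin> I"
    using gen by (metis (no_types, lifting) generators_def mem_Collect_eq)+
next
  assume R: "sl_root i j \<in> I \<and> (\<forall>m. i < m \<and> m < j \<longrightarrow> sl_root i m \<notin> I \<and> sl_root m j \<notin> I)"
  have ij: "1 \<le> i" "i < j" "j \<le> n"
    using R assms sl_root_in_pos_roots_iff[of i j n] by auto
  have "sl_root i j - \<alpha> \<notin> I" if \<alpha>_pos: "\<alpha> \<in> pos_roots n" for \<alpha>
  proof
    assume diff: "sl_root i j - \<alpha> \<in> I"
    obtain p q where \<alpha>: "\<alpha> = sl_root p q" and pq: "1 \<le> p" "p < q" "q \<le> n"
      using \<alpha>_pos by (auto simp: pos_roots_def)
    obtain u v where uv: "sl_root i j - \<alpha> = sl_root u v" "1 \<le> u" "u < v" "v \<le> n"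
      using diff assms by (auto simp: pos_roots_def)
    have sum: "sl_root u v + sl_root p q = sl_root i j"
      using uv(1) \<alpha> by (metis diff_add_cancel)
    have "sl_root i j \<in> roots n"
      using R assms pos_roots_subset_roots by blast
    then consider "v = p" | "q = u"
      using sl_root_add_in_roots sum uv(3) pq(2) by metis
    then show False
    proof cases
      case 1
      then have "sl_root i j = sl_root u q"
        using sum by (simp add: sl_root_add)
      then have "i = u" "j = q"
        using ij(2) by (simp_all add: sl_root_eq_iff)
      then show False
        using R diff uv pq 1 by auto
    next
      case 2
      then have "sl_root i j = sl_root p v"
        using sum by (metis add.commute sl_root_add)
      then have "i = p" "j = v"
        using ij(2) by (simp_all add: sl_root_eq_iff)
      then show False
        using R diff uv pq 2 by auto
    qed
  qed
  then show "sl_root i j \<in> generators n I"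
    using R by (simp add: generators_def)
qed

text \<open>Adding (j, q) moves the right end, then adding (p, i) moves the left end. An end that
  stays put is a separate case, since \<open>sl_root j j\<close> is zero and hence no positive
  root.\<close>

lemma ad_nilpotent_ideal_up_closed:
  assumes "ad_nilpotent_ideal n I" and "sl_root i j \<in> I"
    and "1 \<le> p" and "p \<le> i" and "j \<le> q" and "q \<le> n"
  shows "sl_root p q \<in> I"
proof -
  have ij: "1 \<le> i" "i < j" "j \<le> n"
    using assms(1,2) sl_root_in_pos_roots_iff[of i j n] by (auto simp: ad_nilpotent_ideal_def)
  have add: "\<gamma> + \<nu> \<in> I" if "\<gamma> \<in> I" "\<nu> \<in> pos_roots n" "\<gamma> + \<nu> \<in> pos_roots n" for \<gamma> \<nu>
    using assms(1) that pos_roots_subset_roots[of n] by (auto simp: ad_nilpotent_ideal_def)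
  have "sl_root i q \<in> I"
  proof (cases "j = q")
    case False
    then show ?thesis
      using add[of "sl_root i j" "sl_root j q"] assms ij
      by (simp add: sl_root_add sl_root_in_pos_roots_iff)
  qed (use assms in simp)
  show ?thesis
  proof (cases "p = i")
    case False
    then show ?thesis
      using add[of "sl_root i q" "sl_root p i"] assms ij \<open>sl_root i q \<in> I\<close>
      by (simp add: sl_root_add add.commute[of "sl_root i q"] sl_root_in_pos_roots_iff)
  qed (use \<open>sl_root i q \<in> I\<close> in simp)
qed

section \<open>Starts and ends of the generators of an ideal\<close>

definition gen_pairs :: "nat \<Rightarrow> (nat \<Rightarrow> int) set \<Rightarrow> (nat \<times> nat) set" where
  "gen_pairs n I = {(i, j). sl_root i j \<in> generators n I}"

text \<open>The shift turns a column into the last simple root of the generator, so that starts and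
  ends both lie in {1..n - 1}. For an ideal all columns are at least 2, so nothing is
  truncated.\<close>

definition gen_ends :: "nat \<Rightarrow> (nat \<Rightarrow> int) set \<Rightarrow> nat set" where
  "gen_ends n I = (\<lambda>j. j - 1) ` gen_cols n I"

lemma gen_rows_eq: "gen_rows n I = fst ` gen_pairs n I"
  by (force simp: gen_rows_def gen_pairs_def)

lemma gen_ends_eq: "gen_ends n I = (\<lambda>(i, j). j - 1) ` gen_pairs n I"
  by (force simp: gen_ends_def gen_cols_def gen_pairs_def)

text \<open>For sets of equal size, pair the elements of \<open>A\<close> and \<open>B\<close> in
  increasing order and read (p, b) as the generator (p, b + 1). The inequality says that some such
  generator has i \<le> p and b + 1 \<le> j.\<close>

definition ideal_of :: "nat \<Rightarrow> nat set \<Rightarrow> nat set \<Rightarrow> (nat \<Rightarrow> int) set" where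
  "ideal_of n A B = {sl_root i j | i j. 1 \<le> i \<and> i < j \<and> j \<le> n \<and>
     card (A \<inter> {..<i}) < card (B \<inter> {..<j})}"

text \<open>As the sizes agree, the last condition says that the r-th smallest element of
  \<open>A\<close> is at most that of \<open>B\<close> for every r (the Gale order). In terms of
  counts it is easy to carry over to complements.\<close>

definition dominating_pairs :: "nat \<Rightarrow> nat \<Rightarrow> (nat set \<times> nat set) set" where
  "dominating_pairs n k = {(A, B). A \<subseteq> {1..n - 1} \<and> B \<subseteq> {1..n - 1} \<and>
     card A = k \<and> card B = k \<and> (\<forall>m. card (B \<inter> {..<m}) \<le> card (A \<inter> {..<m}))}"

context
  fixes n :: nat and I :: "(nat \<Rightarrow> int) set"
  assumes ideal: "ad_nilpotent_ideal n I"
begin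

lemma ideal_pos_roots: "I \<subseteq> pos_roots n"
  using ideal by (simp add: ad_nilpotent_ideal_def)

lemma ideal_bounds:
  assumes "sl_root i j \<in> I"
  shows "1 \<le> i" "i < j" "j \<le> n"
  using assms ideal_pos_roots sl_root_in_pos_roots_iff[of i j n] by auto

lemma gen_pairs_in_ideal: "(i, j) \<in> gen_pairs n I \<Longrightarrow> sl_root i j \<in> I"
  by (simp add: gen_pairs_def generators_def)

text \<open>If (p, q) lies inside (i, j), up-closure puts (p, j) and (i, q) into the ideal as well;
  a proper shrinking at either end would then split the generator.\<close>

lemma gen_pairs_minimal:
  assumes "(i, j) \<in> gen_pairs n I" and "sl_root p q \<in> I" and "i \<le> p" and "q \<le> j"
  shows "p = i \<and> q = j"
proof -
  have ij: "1 \<le> i" "i < j" "j \<le> n"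
    using assms(1) gen_pairs_in_ideal ideal_bounds by blast+
  have pq: "p < q" "q \<le> n"
    using assms(2) ideal_bounds by blast+
  have gen: "sl_root i m \<notin> I \<and> sl_root m j \<notin> I" if "i < m" "m < j" for m
    using assms(1) that sl_root_in_generators_iff[OF ideal_pos_roots] by (simp add: gen_pairs_def)
  have "sl_root p j \<in> I" "sl_root i q \<in> I"
    using ad_nilpotent_ideal_up_closed[OF ideal assms(2)] ij pq assms(3,4) by simp_all
  then show ?thesis
    using gen[of p] gen[of q] assms(3,4) pq by (metis le_neq_implies_less less_le_trans le_less_trans)
qed

text \<open>A root of the ideal that is no generator splits so that one of the two shorter pieces is
  in the ideal; descend on the length.\<close>

lemma gen_pairs_below:
  assumes "sl_root i j \<in> I"
  shows "\<exists>(p, q)\<in>gen_pairs n I. i \<le> p \<and> q \<le> j"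
  using assms
proof (induction "j - i" arbitrary: i j rule: less_induct)
  case less
  show ?case
  proof (cases "(i, j) \<in> gen_pairs n I")
    case False
    then obtain m where m: "i < m" "m < j" "sl_root i m \<in> I \<or> sl_root m j \<in> I"
      using less.prems sl_root_in_generators_iff[OF ideal_pos_roots] by (auto simp: gen_pairs_def)
    then have "m - i < j - i" "j - m < j - i"
      by linarith+
    from m(3) show ?thesis
    proof
      assume "sl_root i m \<in> I"
      then obtain p q where "(p, q) \<in> gen_pairs n I" "i \<le> p" "q \<le> m"
        using less.hyps[OF \<open>m - i < j - i\<close>] by auto
      then show ?thesis
        using m(2) by (intro bexI[of _ "(p, q)"]) auto
    next
      assume "sl_root m j \<in> I"
      then obtain p q where "(p, q) \<in> gen_pairs n I" "m \<le> p" "q \<le> j"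
        using less.hyps[OF \<open>j - m < j - i\<close>] by auto
      then show ?thesis
        using m(1) by (intro bexI[of _ "(p, q)"]) auto
    qed
  qed auto
qed

text \<open>Otherwise one generator would lie properly inside the other, against minimality. Hence
  starts and ends order the generators in the same way, and either one determines the
  generator.\<close>

lemma gen_pairs_less_iff:
  assumes "(i, j) \<in> gen_pairs n I" and "(p, q) \<in> gen_pairs n I"
  shows "i < p \<longleftrightarrow> j < q"
  using gen_pairs_minimal[OF assms(1) gen_pairs_in_ideal[OF assms(2)]]
    gen_pairs_minimal[OF assms(2) gen_pairs_in_ideal[OF assms(1)]]
  by linarith

lemma gen_pairs_bounds:
  assumes "(i, j) \<in> gen_pairs n I"
  shows "1 \<le> i" "i < j" "j \<le> n"
  using assms gen_pairs_in_ideal ideal_bounds by blast+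

lemma finite_gen_pairs: "finite (gen_pairs n I)"
proof (rule finite_subset)
  show "gen_pairs n I \<subseteq> {..n} \<times> {..n}"
  proof (rule subrelI)
    fix i j assume "(i, j) \<in> gen_pairs n I"
    from gen_pairs_bounds[OF this] show "(i, j) \<in> {..n} \<times> {..n}"
      by simp
  qed
qed simp

lemma inj_on_gen_starts: "inj_on fst (gen_pairs n I)"
proof (rule inj_onI, clarify)
  fix i j p q assume g: "(i, j) \<in> gen_pairs n I" "(p, q) \<in> gen_pairs n I" and "fst (i, j) = fst (p, q)"
  then show "i = p \<and> j = q"
    using gen_pairs_less_iff[OF g] gen_pairs_less_iff[OF g(2) g(1)] by auto
qed

lemma inj_on_gen_ends: "inj_on (\<lambda>(i, j). j - 1) (gen_pairs n I)"
proof (rule inj_onI, clarify)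
  fix i j p q assume g: "(i, j) \<in> gen_pairs n I" "(p, q) \<in> gen_pairs n I" and "j - 1 = q - 1"
  then have "j = q"
    using gen_pairs_bounds[OF g(1)] gen_pairs_bounds[OF g(2)] by linarith
  then show "i = p \<and> j = q"
    using gen_pairs_less_iff[OF g] gen_pairs_less_iff[OF g(2) g(1)] by auto
qed

lemma card_gen_rows: "card (gen_rows n I) = card (gen_pairs n I)"
  by (simp add: gen_rows_eq card_image inj_on_gen_starts)

lemma card_gen_ends: "card (gen_ends n I) = card (gen_pairs n I)"
  by (simp only: gen_ends_eq card_image[OF inj_on_gen_ends])

lemma card_generators: "card (generators n I) = card (gen_pairs n I)"
proof -
  have "\<exists>i j. \<gamma> = sl_root i j" if "\<gamma> \<in> generators n I" for \<gamma>
  proof -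
    have "\<gamma> \<in> pos_roots n"
      using that ideal_pos_roots by (auto simp: generators_def)
    then show ?thesis
      by (auto simp: pos_roots_def)
  qed
  then have "generators n I = (\<lambda>(i, j). sl_root i j) ` gen_pairs n I"
    by (fastforce simp: gen_pairs_def)
  moreover have "inj_on (\<lambda>(i, j). sl_root i j) (gen_pairs n I)"
    by (rule inj_onI) (auto simp: sl_root_eq_iff dest: gen_pairs_bounds(2))
  ultimately show ?thesis
    by (simp add: card_image)
qed

lemma card_gen_rows_below:
  "card (gen_rows n I \<inter> {..<m}) = card {(i, j) \<in> gen_pairs n I. i < m}"
proof -
  have "gen_rows n I \<inter> {..<m} = fst ` {(i, j) \<in> gen_pairs n I. i < m}"
    by (force simp: gen_rows_eq)
  then show ?thesis
    using card_image[OF inj_on_subset[OF inj_on_gen_starts, of "{(i, j) \<in> gen_pairs n I. i < m}"]]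
    by auto
qed

lemma card_gen_ends_below:
  "card (gen_ends n I \<inter> {..<m}) = card {(i, j) \<in> gen_pairs n I. j \<le> m}"
proof -
  have "gen_ends n I \<inter> {..<m} = (\<lambda>(i, j). j - 1) ` {(i, j) \<in> gen_pairs n I. j \<le> m}"
  proof -
    \<comment> \<open>The shift makes a strict bound on the end a weak bound on the column; this
      needs j > 0.\<close>
    have "j - 1 < m \<longleftrightarrow> j \<le> m" if "(i, j) \<in> gen_pairs n I" for i j
      using gen_pairs_bounds[OF that] by auto
    then show ?thesis
      by (auto simp: gen_ends_eq)
  qed
  then show ?thesis
    using card_image[OF inj_on_subset[OF inj_on_gen_ends, of "{(i, j) \<in> gen_pairs n I. j \<le> m}"]]
    by auto
qed

text \<open>Domination comes from i < j: a generator with j \<le> m also has i < m, so the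
  generators counted through their ends are among those counted through their starts.\<close>

lemma gen_rows_ends_dominating:
  "(gen_rows n I, gen_ends n I) \<in> dominating_pairs n (card (generators n I))"
proof -
  have "card (gen_ends n I \<inter> {..<m}) \<le> card (gen_rows n I \<inter> {..<m})" for m
    unfolding card_gen_rows_below card_gen_ends_below
    by (rule card_mono) (auto intro: finite_subset[OF _ finite_gen_pairs] dest: gen_pairs_bounds)
  moreover have "gen_rows n I \<subseteq> {1..n - 1}" "gen_ends n I \<subseteq> {1..n - 1}"
    unfolding gen_rows_eq gen_ends_eq
    by (auto dest: gen_pairs_bounds) (use gen_pairs_bounds in fastforce)+
  ultimately show ?thesis
    by (simp add: dominating_pairs_def card_gen_rows card_gen_ends card_generators)
qed

text \<open>
  The generators form a chain, of which those starting before \<open>i\<close> and those ending before \<open>j\<close> are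
  initial segments; hence comparing the sizes of these segments amounts to comparing them by
  inclusion.
\<close>

lemma in_ideal_iff_card:
  assumes "1 \<le> i" and "j \<le> n"
  shows "sl_root i j \<in> I \<longleftrightarrow> card (gen_rows n I \<inter> {..<i}) < card (gen_ends n I \<inter> {..<j})"
proof -
  define X where "X = {(p, q) \<in> gen_pairs n I. p < i}"
  define Y where "Y = {(p, q) \<in> gen_pairs n I. q \<le> j}"
  have fin: "finite X" "finite Y"
    unfolding X_def Y_def by (auto intro: finite_subset[OF _ finite_gen_pairs])
  \<comment> \<open>An ideal is the up-closure of its generators.\<close>
  have "sl_root i j \<in> I \<longleftrightarrow> (\<exists>(p, q)\<in>gen_pairs n I. i \<le> p \<and> q \<le> j)"
    using gen_pairs_below ad_nilpotent_ideal_up_closed[OF ideal gen_pairs_in_ideal] assms by blast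
  also have "\<dots> \<longleftrightarrow> \<not> Y \<subseteq> X"
    by (force simp: X_def Y_def)
  also have "\<dots> \<longleftrightarrow> card X < card Y"
  proof
    assume "\<not> Y \<subseteq> X"
    then obtain p q where pq: "(p, q) \<in> gen_pairs n I" "q \<le> j" "i \<le> p"
      by (auto simp: X_def Y_def) (meson not_le_imp_less)
    have "X \<subseteq> Y"
    proof (clarsimp simp: X_def Y_def)
      fix u v assume uv: "(u, v) \<in> gen_pairs n I" "u < i"
      then show "v \<le> j"
        using gen_pairs_less_iff[OF uv(1) pq(1)] pq by linarith
    qed
    then show "card X < card Y"
      using \<open>\<not> Y \<subseteq> X\<close> fin by (metis psubsetI psubset_card_mono subset_refl)
  next
    assume "card X < card Y"
    then show "\<not> Y \<subseteq> X"
      by (meson card_mono fin(1) not_less)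
  qed
  finally show ?thesis
    by (simp add: card_gen_rows_below card_gen_ends_below X_def Y_def)
qed

lemma ideal_of_gen_rows_ends: "ideal_of n (gen_rows n I) (gen_ends n I) = I"
proof (intro set_eqI iffI)
  fix \<gamma> assume "\<gamma> \<in> ideal_of n (gen_rows n I) (gen_ends n I)"
  then show "\<gamma> \<in> I"
    by (auto simp: ideal_of_def in_ideal_iff_card)
next
  fix \<gamma> assume "\<gamma> \<in> I"
  moreover from this obtain i j where "\<gamma> = sl_root i j" "1 \<le> i" "i < j" "j \<le> n"
    using ideal_pos_roots by (auto simp: pos_roots_def)
  ultimately show "\<gamma> \<in> ideal_of n (gen_rows n I) (gen_ends n I)"
    using in_ideal_iff_card[of i j] by (auto simp: ideal_of_def)
qed

end

section \<open>Ranks of elements in sets of natural numbers\<close>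

lemma card_Int_lessThan_Suc:
  "card (A \<inter> {..<Suc a}) = (if a \<in> A then Suc (card (A \<inter> {..<a})) else card (A \<inter> {..<a}))"
  by (simp add: lessThan_Suc Int_insert_right)

lemma card_Int_lessThan_mono: "i \<le> j \<Longrightarrow> card (A \<inter> {..<i}) \<le> card (A \<inter> {..<j})" for i j :: nat
  by (rule card_mono) auto

lemma rank_less_card:
  fixes c :: nat
  assumes "finite C" and "c \<in> C"
  shows "card (C \<inter> {..<c}) < card C"
  by (rule psubset_card_mono) (use assms in auto)

text \<open>The count below a bound starts at 0 and rises by at most 1 at each step. Where it first
  exceeds \<open>s\<close>, it jumps from exactly \<open>s\<close>, and it jumps only at elements of
  \<open>A\<close>.\<close>

lemma ex_elem_of_rank:
  fixes A :: "nat set"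
  assumes "finite A" and "s < card A"
  shows "\<exists>a\<in>A. card (A \<inter> {..<a}) = s"
proof -
  obtain m where "A \<subseteq> {..<m}"
    using assms(1) finite_nat_set_iff_bounded[of A] by blast
  then have "s < card (A \<inter> {..<m})"
    using assms(2) by (simp add: Int_absorb2)
  then obtain a where "\<not> s < card (A \<inter> {..<a})" "s < card (A \<inter> {..<Suc a})"
    using ex_least_nat_less[of "\<lambda>m. s < card (A \<inter> {..<m})" m] by auto
  then show ?thesis
    by (intro bexI[of _ a]) (auto simp: card_Int_lessThan_Suc split: if_splits)
qed

section \<open>The ideal attached to a dominating pair\<close>

context
  fixes n k :: nat and A B :: "nat set"
  assumes dom: "(A, B) \<in> dominating_pairs n k"
begin

lemma dominating_bounds:
  "A \<subseteq> {1..n - 1}" "B \<subseteq> {1..n - 1}" "finite A" "finite B" "card A = k" "card B = k"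
  "card (B \<inter> {..<m}) \<le> card (A \<inter> {..<m})"
  using dom finite_subset[OF _ finite_atLeastAtMost] by (auto simp: dominating_pairs_def)

lemma less_if_rank_less:
  assumes "card (A \<inter> {..<i}) < card (B \<inter> {..<j})"
  shows "i < j"
proof (rule ccontr)
  assume "\<not> i < j"
  then have "card (B \<inter> {..<j}) \<le> card (B \<inter> {..<i})"
    by (simp add: card_Int_lessThan_mono)
  then show False
    using assms dominating_bounds(7)[of i] by linarith
qed

lemma in_ideal_of_iff:
  "sl_root i j \<in> ideal_of n A B \<longleftrightarrow>
    1 \<le> i \<and> j \<le> n \<and> card (A \<inter> {..<i}) < card (B \<inter> {..<j})"
proof
  assume "sl_root i j \<in> ideal_of n A B"
  then obtain p q where pq: "sl_root p q = sl_root i j" "1 \<le> p" "p < q" "q \<le> n"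
    "card (A \<inter> {..<p}) < card (B \<inter> {..<q})"
    by (auto simp: ideal_of_def)
  then have "p = i" "q = j"
    by (simp_all add: sl_root_eq_iff)
  then show "1 \<le> i \<and> j \<le> n \<and> card (A \<inter> {..<i}) < card (B \<inter> {..<j})"
    using pq by simp
next
  assume R: "1 \<le> i \<and> j \<le> n \<and> card (A \<inter> {..<i}) < card (B \<inter> {..<j})"
  then have "i < j"
    using less_if_rank_less by blast
  then show "sl_root i j \<in> ideal_of n A B"
    using R by (auto simp: ideal_of_def)
qed

lemma ideal_of_subset: "ideal_of n A B \<subseteq> pos_roots n"
  by (auto simp: ideal_of_def pos_roots_def)

lemma ad_nilpotent_ideal_of: "ad_nilpotent_ideal n (ideal_of n A B)"
  unfolding ad_nilpotent_ideal_def
proof (intro conjI ballI impI)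
  fix \<gamma> \<nu> assume \<gamma>: "\<gamma> \<in> ideal_of n A B" and \<nu>: "\<nu> \<in> pos_roots n" and sum: "\<gamma> + \<nu> \<in> roots n"
  obtain i j where ij: "\<gamma> = sl_root i j" "1 \<le> i" "i < j" "j \<le> n"
    "card (A \<inter> {..<i}) < card (B \<inter> {..<j})"
    using \<gamma> by (auto simp: ideal_of_def)
  obtain p q where pq: "\<nu> = sl_root p q" "1 \<le> p" "p < q" "q \<le> n"
    using \<nu> by (auto simp: pos_roots_def)
  consider "j = p" | "q = i"
    using sl_root_add_in_roots sum ij pq by metis
  then show "\<gamma> + \<nu> \<in> ideal_of n A B"
  proof cases
    case 1
    then have "\<gamma> + \<nu> = sl_root i q"
      using ij pq by (simp add: sl_root_add)
    then show ?thesis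
      using ij pq 1 card_Int_lessThan_mono[of j q B] by (simp add: in_ideal_of_iff)
  next
    case 2
    then have "\<gamma> + \<nu> = sl_root p j"
      using ij pq by (simp add: sl_root_add add.commute[of "sl_root i j"])
    then show ?thesis
      using ij pq 2 card_Int_lessThan_mono[of p i A] by (simp add: in_ideal_of_iff)
  qed
qed (rule ideal_of_subset)

text \<open>The generators match starts and ends of equal rank. Shrinking a generator by one step at
  either end must destroy the strict inequality, so the count of \<open>A\<close> jumps at
  \<open>i\<close> and that of \<open>B\<close> at \<open>j - 1\<close>. Conversely, after these two
  jumps monotonicity of the counts excludes every shorter piece.\<close>

lemma gen_pairs_ideal_of:
  "(i, j) \<in> gen_pairs n (ideal_of n A B) \<longleftrightarrow>
    i \<in> A \<and> j - 1 \<in> B \<and> card (B \<inter> {..<j - 1}) = card (A \<inter> {..<i})"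
  (is "?L \<longleftrightarrow> ?R")
proof
  assume ?L
  then have ij: "sl_root i j \<in> ideal_of n A B"
    by (rule gen_pairs_in_ideal[OF ad_nilpotent_ideal_of])
  then have less: "1 \<le> i" "j \<le> n" "card (A \<inter> {..<i}) < card (B \<inter> {..<j})"
    by (simp_all add: in_ideal_of_iff)
  have "i < j"
    using less(3) by (rule less_if_rank_less)
  have "sl_root (Suc i) j \<notin> ideal_of n A B" "sl_root i (j - 1) \<notin> ideal_of n A B"
    using gen_pairs_minimal[OF ad_nilpotent_ideal_of \<open>?L\<close>, of "Suc i" j]
      gen_pairs_minimal[OF ad_nilpotent_ideal_of \<open>?L\<close>, of i "j - 1"] \<open>i < j\<close>
    by auto
  then have "card (B \<inter> {..<j}) \<le> card (A \<inter> {..<Suc i})" "card (B \<inter> {..<j - 1}) \<le> card (A \<inter> {..<i})"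
    using less by (auto simp: in_ideal_of_iff)
  then show ?R
    using less(3) card_Int_lessThan_Suc[of A i] card_Int_lessThan_Suc[of B "j - 1"] \<open>i < j\<close>
    by (auto split: if_splits)
next
  assume R: ?R
  \<comment> \<open>Since 0 is not in \<open>B\<close>, having \<open>j - 1\<close> in
    \<open>B\<close> rules out the truncated case j = 0.\<close>
  have j: "Suc (j - 1) = j" "j \<le> n" "1 \<le> i"
    using R dominating_bounds(1,2) by force+
  have card: "card (B \<inter> {..<j}) = Suc (card (A \<inter> {..<i}))"
    using R j card_Int_lessThan_Suc[of B "j - 1"] by simp
  have "sl_root i m \<notin> ideal_of n A B \<and> sl_root m j \<notin> ideal_of n A B" if m: "i < m" "m < j" for m
  proof -
    have "m \<le> j - 1"
      using m(2) by linarith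
    then show ?thesis
      using card_Int_lessThan_mono[of m "j - 1" B] card_Int_lessThan_mono[of "Suc i" m A]
        card_Int_lessThan_Suc[of A i] R j m card
      by (auto simp: in_ideal_of_iff)
  qed
  then show ?L
    using j card by (simp add: gen_pairs_def sl_root_in_generators_iff[OF ideal_of_subset]
        in_ideal_of_iff)
qed

lemma gen_rows_ideal_of: "gen_rows n (ideal_of n A B) = A"
proof
  show "A \<subseteq> gen_rows n (ideal_of n A B)"
  proof
    fix i assume "i \<in> A"
    \<comment> \<open>As \<open>A\<close> and \<open>B\<close> have the same size, the rank of
      \<open>i\<close> in \<open>A\<close> is also attained in \<open>B\<close>; the partner
      \<open>b\<close> is an end, so its column is \<open>Suc b\<close>.\<close>
    then obtain b where "b \<in> B" "card (B \<inter> {..<b}) = card (A \<inter> {..<i})"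
      using ex_elem_of_rank[of B] rank_less_card[of A i] dominating_bounds by metis
    then have "(i, Suc b) \<in> gen_pairs n (ideal_of n A B)"
      using \<open>i \<in> A\<close> by (simp add: gen_pairs_ideal_of)
    then show "i \<in> gen_rows n (ideal_of n A B)"
      by (force simp: gen_rows_eq)
  qed
qed (auto simp: gen_rows_eq gen_pairs_ideal_of)

lemma gen_ends_ideal_of: "gen_ends n (ideal_of n A B) = B"
proof
  show "B \<subseteq> gen_ends n (ideal_of n A B)"
  proof
    fix b assume "b \<in> B"
    then obtain i where "i \<in> A" "card (B \<inter> {..<b}) = card (A \<inter> {..<i})"
      using ex_elem_of_rank[of A] rank_less_card[of B b] dominating_bounds by metis
    then have "(i, Suc b) \<in> gen_pairs n (ideal_of n A B)"
      using \<open>b \<in> B\<close> by (simp add: gen_pairs_ideal_of)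
    then show "b \<in> gen_ends n (ideal_of n A B)"
      by (force simp: gen_ends_eq)
  qed
qed (auto simp: gen_ends_eq gen_pairs_ideal_of)

lemma ideal_of_in_Ad: "ideal_of n A B \<in> Ad n k"
  using card_generators[OF ad_nilpotent_ideal_of] card_gen_rows[OF ad_nilpotent_ideal_of]
  by (simp add: Ad_def ad_nilpotent_ideal_of gen_rows_ideal_of dominating_bounds)

end

section \<open>Ideals as dominating pairs, and their duality\<close>

lemma bij_betw_Ad_dominating_pairs:
  "bij_betw (\<lambda>I. (gen_rows n I, gen_ends n I)) (Ad n k) (dominating_pairs n k)"
  by (rule bij_betw_byWitness[where f' = "\<lambda>(A, B). ideal_of n A B"])
    (use gen_rows_ends_dominating in \<open>auto simp: Ad_def ideal_of_gen_rows_ends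
      gen_rows_ideal_of gen_ends_ideal_of ideal_of_in_Ad[unfolded Ad_def, simplified]\<close>)

text \<open>The inverse is kept as the explicit map, so that the starts and ends of an ideal in its
  image can be computed.\<close>

lemma bij_betw_dominating_pairs_ideal_of:
  "bij_betw (\<lambda>(A, B). ideal_of n A B) (dominating_pairs n k) (Ad n k)"
  by (rule bij_betw_byWitness[where f' = "\<lambda>I. (gen_rows n I, gen_ends n I)"])
    (use gen_rows_ends_dominating in \<open>auto simp: Ad_def ideal_of_gen_rows_ends
      gen_rows_ideal_of gen_ends_ideal_of ideal_of_in_Ad[unfolded Ad_def, simplified]\<close>)

definition dual_pair :: "nat \<Rightarrow> nat set \<times> nat set \<Rightarrow> nat set \<times> nat set" where
  "dual_pair n = (\<lambda>(A, B). ({1..n - 1} - B, {1..n - 1} - A))"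

text \<open>Below each \<open>m\<close>, complementing subtracts the count from a fixed total and so
  reverses the inequality; exchanging the two sets restores it.\<close>

lemma dual_pair_dominating:
  assumes "P \<in> dominating_pairs n k"
  shows "dual_pair n P \<in> dominating_pairs n (n - k - 1)"
proof -
  obtain A B where P: "P = (A, B)"
    by fastforce
  note AB = dominating_bounds[OF assms[unfolded P]]
  have below: "card (({1..n - 1} - C) \<inter> {..<m}) = card ({1..n - 1} \<inter> {..<m}) - card (C \<inter> {..<m})"
    if "C \<subseteq> {1..n - 1}" for C m
  proof -
    have "({1..n - 1} - C) \<inter> {..<m} = {1..n - 1} \<inter> {..<m} - C \<inter> {..<m}"
      by auto
    moreover have "C \<inter> {..<m} \<subseteq> {1..n - 1} \<inter> {..<m}"
      using that by auto
    ultimately show ?thesis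
      by (simp add: card_Diff_subset)
  qed
  have "card (({1..n - 1} - A) \<inter> {..<m}) \<le> card (({1..n - 1} - B) \<inter> {..<m})" for m
    using below[OF AB(1)] below[OF AB(2)] AB(7)[of m] by (simp add: diff_le_mono2)
  then show ?thesis
    using AB(1-6) by (auto simp: P dual_pair_def dominating_pairs_def card_Diff_subset)
qed

lemma dual_pair_involutive:
  assumes "P \<in> dominating_pairs n k"
  shows "dual_pair n (dual_pair n P) = P"
  using assms by (auto simp: dual_pair_def dominating_pairs_def)

lemma bij_betw_dual_pair:
  assumes "n \<ge> 1" and "k \<le> n - 1"
  shows "bij_betw (dual_pair n) (dominating_pairs n k) (dominating_pairs n (n - k - 1))"
proof (rule bij_betw_byWitness[where f' = "dual_pair n"])
  \<comment> \<open>The bound on \<open>k\<close> keeps the subtractions from truncating, so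
    dualizing twice returns to \<open>k\<close> generators.\<close>
  have "n - (n - k - 1) - 1 = k"
    using assms by simp
  then show "dual_pair n ` dominating_pairs n (n - k - 1) \<subseteq> dominating_pairs n k"
    using dual_pair_dominating[of _ n "n - k - 1"] by auto
qed (use dual_pair_involutive dual_pair_dominating in blast)+

theorem theorem4p2:
  fixes n k :: nat
  assumes "n \<ge> 1" and "k \<le> n - 1"
  shows "\<exists>\<Phi>. bij_betw \<Phi> (Ad n k) (Ad n (n - k - 1)) \<and>
              (\<forall>I\<in>Ad n k. dual_ideals n I (\<Phi> I))"
proof (intro exI conjI ballI)
  let ?F = "\<lambda>I. (gen_rows n I, gen_ends n I)"
  let ?G = "\<lambda>(A, B). ideal_of n A B"
  \<comment> \<open>The map reads off starts and ends, dualizes the pair and rebuilds an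
    ideal.\<close>
  show "bij_betw (?G \<circ> (dual_pair n \<circ> ?F)) (Ad n k) (Ad n (n - k - 1))"
    by (intro bij_betw_trans[OF bij_betw_trans[OF bij_betw_Ad_dominating_pairs
            bij_betw_dual_pair[OF assms]] bij_betw_dominating_pairs_ideal_of])
  fix I assume "I \<in> Ad n k"
  then have "dual_pair n (?F I) \<in> dominating_pairs n (n - k - 1)"
    using bij_betwE[OF bij_betw_Ad_dominating_pairs] dual_pair_dominating by blast
  \<comment> \<open>Because the dual pair is again dominating, the rebuilt ideal has exactly these
    starts and ends, which is what duality of ideals asks for.\<close>
  then have dual: "({1..n - 1} - gen_ends n I, {1..n - 1} - gen_rows n I)
      \<in> dominating_pairs n (n - k - 1)"
    by (simp add: dual_pair_def)
  show "dual_ideals n I ((?G \<circ> (dual_pair n \<circ> ?F)) I)"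
    using gen_rows_ideal_of[OF dual] gen_ends_ideal_of[OF dual]
    by (simp add: dual_ideals_def dual_pair_def gen_ends_def)
qed

end
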